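(* For each $d$ there is a constant $C\ge1$ depending only on $d$ such that the following holds. Let $E\subset\mathbb{R}^d$ be a nonempty closed set with $E\ne\mathbb{R}^d$, let $\mathcal{W}(\mathbb{R}^d\setminus E)$ be a Whitney cover of $\mathbb{R}^d\setminus E$, and let $B_0$ be a closed ball centered at a point of $E$. If $k\in\mathbb{Z}$ and $2^{-k-1}<r\le2^{-k}$, then $$\mathcal{H}^{d-1}(\partial E_r\cap B_0)\le C\,r^{d-1}\sum_{j=k+2}^{k+4}\#\mathcal{W}_j(\mathbb{R}^d\setminus E;B_0).$$
   Context: $E_r=\{x\in\mathbb{R}^d:\operatorname{dist}(x,E)<r\}$, $\partial E_r=\{x\in\mathbb{R}^d:\operatorname{dist}(x,E)=r\}$, and $\mathcal{H}^{d-1}$ is the $(d-1)$-dimensional Hausdorff measure. Whitney cover: for an open set $\Omega\subsetneq\mathbb{R}^d$, a Whitney cover $\mathcal{W}(\Omega)$ is a countable collection $\{B_i\}_{i\in I}$ of closed balls $B_i=B(x_i,r_i)$ with $x_i\in\Omega$, $r_i=\frac18\operatorname{dist}(x_i,\mathbb{R}^d\setminus\Omega)$, $\Omega=\bigcup_iB_i$, and $\sum_i\chi_{B_i}\le C'$ for some constant $C'\ge1$. For $k\in\mathbb{Z}$ and $A\subset\mathbb{R}^d$, $\mathcal{W}_k(\Omega;A)=\{B(x_i,r_i)\in\mathcal{W}(\Omega):2^{-k-1}<r_i\le2^{-k},\ A\cap B(x_i,r_i)\neq\emptyset\}$. *)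

theory Defs
  imports "HOL-Analysis.Analysis"
begin

text \<open>The factor is the usual normalisation, under which the measure of dimension \<open>d\<close> on
  \<open>\<real>\<^sup>d\<close> is Lebesgue measure. The empty set is treated separately because
  \<open>0 ^ 0 = 1\<close>: in dimension \<open>0\<close> (counting measure) only nonempty sets have weight \<open>1\<close>.\<close>

definition hausdorff_weight :: "nat \<Rightarrow> 'a::metric_space set \<Rightarrow> ennreal" where
  "hausdorff_weight m U =
     (if U = {} then 0 else ennreal (unit_ball_vol (real m) * (diameter U / 2) ^ m))"

text \<open>Boundedness is required explicitly because the diameter of an unbounded set is an
  unspecified real number in the library.\<close>

definition hausdorff_premeasure ::
    "nat \<Rightarrow> real \<Rightarrow> 'a::metric_space set \<Rightarrow> ennreal" where
  "hausdorff_premeasure m \<delta> A =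
     (INF U \<in> {U :: nat \<Rightarrow> 'a set.
          A \<subseteq> (\<Union>i. U i) \<and> (\<forall>i. bounded (U i) \<and> diameter (U i) \<le> \<delta>)}.
        (\<Sum>i. hausdorff_weight m (U i)))"

definition hausdorff_measure :: "nat \<Rightarrow> 'a::metric_space set \<Rightarrow> ennreal" where
  "hausdorff_measure m A = (SUP \<delta> \<in> {0<..}. hausdorff_premeasure m \<delta> A)"

definition whitney_radius :: "'a::metric_space set \<Rightarrow> 'a \<Rightarrow> real" where
  "whitney_radius \<Omega> x = infdist x (- \<Omega>) / 8"

text \<open>The collection is a set of balls (as sets of points); the sum in the last conjunct is taken in
  the extended nonnegative reals, so that it cannot be junk for an infinite collection.\<close>

definition whitney_cover :: "'a::metric_space set \<Rightarrow> 'a set set \<Rightarrow> bool" where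
  "whitney_cover \<Omega> W \<longleftrightarrow>
     open \<Omega> \<and> \<Omega> \<noteq> UNIV \<and> countable W \<and>
     (\<forall>B\<in>W. \<exists>x\<in>\<Omega>. B = cball x (whitney_radius \<Omega> x)) \<and>
     \<Omega> = \<Union>W \<and>
     (\<exists>C'::real. C' \<ge> 1 \<and> (\<forall>y. (\<Sum>\<^sub>\<infinity>B\<in>W. (indicator B y :: ennreal)) \<le> ennreal C'))"

definition whitney_layer ::
    "'a::metric_space set \<Rightarrow> 'a set set \<Rightarrow> int \<Rightarrow> 'a set \<Rightarrow> 'a set set" where
  "whitney_layer \<Omega> W k A =
     {B \<in> W. A \<inter> B \<noteq> {} \<and>
        (\<exists>x\<in>\<Omega>. B = cball x (whitney_radius \<Omega> x) \<and>
           2 powi (- k - 1) < whitney_radius \<Omega> x \<and> whitney_radius \<Omega> x \<le> 2 powi (- k))}"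

text \<open>The cardinality is infinite for infinite sets, unlike \<open>card\<close>.\<close>

definition ennreal_card :: "'b set \<Rightarrow> ennreal" where
  "ennreal_card S = emeasure (count_space UNIV) S"

text \<open>For nonempty \<open>E\<close> in Euclidean space and \<open>r > 0\<close> this level set is the topological boundary
  of the open tubular neighbourhood \<open>{x. infdist x E < r}\<close>.\<close>

definition tube_boundary :: "'a::metric_space set \<Rightarrow> real \<Rightarrow> 'a set" where
  "tube_boundary E r = {x. infdist x E = r}"

end

theory Submission
  imports Defs
begin

text \<open>Every point \<open>y\<close> of the level set at distance \<open>r\<close> is seen from a nearest point of \<open>E\<close> in a unit
  direction \<open>n y\<close>, and no other point of the level set enters the open ball of radius \<open>r\<close> around
  that nearest point. Hence, if \<open>y\<close> and \<open>z\<close> are close compared with \<open>r\<close> and \<open>n y\<close> is close to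
  \<open>n z\<close>, then \<open>z - y\<close> is almost orthogonal to \<open>n y\<close>, so it is controlled by its coordinates other
  than the one in which \<open>n y\<close> is largest. Splitting the piece of the level set in a ball of radius
  \<open>r\<close> into boundedly many parts by position and direction, each part is a Lipschitz graph over a
  coordinate hyperplane, and a grid of mesh \<open>r / m\<close> in that hyperplane cuts it into
  \<open>O(m\<^sup>d\<^sup>-\<^sup>1)\<close> sets of diameter at most \<open>2 r / m\<close>. Finally, a Whitney ball meeting the level set has
  radius between \<open>r / 9\<close> and \<open>r / 7\<close>, so it belongs to one of the three layers.\<close>

section \<open>Hausdorff measure\<close>

text \<open>The premeasure ranges over sequences, so an enumeration of the finite cover is continued
  by empty sets. These have weight 0 even for \<open>n = 0\<close>, so the series reduces to
  \<open>card \<U>\<close> terms.\<close>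

lemma hausdorff_premeasure_le_finite_cover:
  assumes "finite \<U>" "A \<subseteq> \<Union>\<U>" "0 < \<delta>" "c \<le> \<delta>"
    and U: "\<And>U. U \<in> \<U> \<Longrightarrow> bounded U \<and> diameter U \<le> c"
  shows "hausdorff_premeasure n \<delta> A
    \<le> of_nat (card \<U>) * ennreal (unit_ball_vol (real n) * (c / 2) ^ n)"
proof -
  obtain h where h: "bij_betw h {0..<card \<U>} \<U>"
    using ex_bij_betw_nat_finite[OF \<open>finite \<U>\<close>] by blast
  define V where "V i = (if i < card \<U> then h i else {})" for i
  have hU: "h i \<in> \<U>" if "i < card \<U>" for i
    using h that by (auto simp: bij_betw_def)
  have "A \<subseteq> (\<Union>i. V i)"
  proof
    fix y assume "y \<in> A"
    then obtain U where "U \<in> \<U>" "y \<in> U" using assms(2) by blast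
    then obtain i where "i < card \<U>" "U = h i"
      using bij_betw_imp_surj_on[OF h] by (metis atLeastLessThan_iff imageE)
    then show "y \<in> (\<Union>i. V i)" using \<open>y \<in> U\<close> by (auto simp: V_def)
  qed
  moreover have "bounded (V i) \<and> diameter (V i) \<le> \<delta>" for i
    using U[OF hU[of i]] assms(3,4) by (auto simp: V_def)
  ultimately have "hausdorff_premeasure n \<delta> A \<le> (\<Sum>i. hausdorff_weight n (V i))"
    unfolding hausdorff_premeasure_def by (intro INF_lower) auto
  also have "\<dots> = (\<Sum>i<card \<U>. hausdorff_weight n (V i))"
    by (intro suminf_finite) (auto simp: V_def hausdorff_weight_def)
  also have "\<dots> \<le> (\<Sum>i<card \<U>. ennreal (unit_ball_vol (real n) * (c / 2) ^ n))"
  proof (rule sum_mono)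
    fix i assume "i \<in> {..<card \<U>}"
    then have "bounded (V i)" "diameter (V i) \<le> c"
      using U[OF hU[of i]] by (auto simp: V_def)
    then have "(diameter (V i) / 2) ^ n \<le> (c / 2) ^ n"
      using diameter_ge_0 by (intro power_mono) auto
    then show "hausdorff_weight n (V i) \<le> ennreal (unit_ball_vol (real n) * (c / 2) ^ n)"
      by (auto simp: hausdorff_weight_def intro!: ennreal_leI mult_left_mono)
  qed
  finally show ?thesis by simp
qed

text \<open>Sets of diameter at most \<open>\<rho> / m\<close> weigh at most a constant times
  \<open>(\<rho> / m) ^ n\<close>, which cancels the growth \<open>m ^ n\<close> of their number.
  The bound is therefore the same at every scale \<open>\<delta>\<close> and survives the
  supremum.\<close>

lemma hausdorff_measure_le_covers:
  assumes "0 \<le> \<rho>"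
    and cov: "\<And>m::nat. 0 < m \<Longrightarrow> \<exists>\<U>. finite \<U> \<and> A \<subseteq> \<Union>\<U> \<and> card \<U> \<le> N * m ^ n \<and>
                (\<forall>U\<in>\<U>. bounded U \<and> diameter U \<le> \<rho> / real m)"
  shows "hausdorff_measure n A \<le> ennreal (real N * unit_ball_vol (real n) * (\<rho> / 2) ^ n)"
  unfolding hausdorff_measure_def
proof (rule SUP_least)
  fix \<delta> :: real assume "\<delta> \<in> {0<..}"
  then have "0 < \<delta>" by simp
  \<comment> \<open>A mesh this fine makes \<open>\<rho> / m \<le> \<delta>\<close>, so the cover is
    admissible for \<open>\<delta>\<close>.\<close>
  obtain m :: nat where m: "\<rho> / \<delta> < real m" using reals_Archimedean2 by blast
  have "0 < m" using m \<open>0 < \<delta>\<close> \<open>0 \<le> \<rho>\<close>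
    by (metis divide_nonneg_pos gr0I leD of_nat_0)
  have "\<rho> / real m \<le> \<delta>" using m \<open>0 < m\<close> \<open>0 < \<delta>\<close> by (simp add: field_simps)
  obtain \<U> where \<U>: "finite \<U>" "A \<subseteq> \<Union>\<U>" "card \<U> \<le> N * m ^ n"
    "\<And>U. U \<in> \<U> \<Longrightarrow> bounded U \<and> diameter U \<le> \<rho> / real m"
    using cov[OF \<open>0 < m\<close>] by blast
  let ?w = "unit_ball_vol (real n) * (\<rho> / real m / 2) ^ n"
  have w: "0 \<le> ?w" using \<open>0 \<le> \<rho>\<close> by simp
  have "hausdorff_premeasure n \<delta> A \<le> of_nat (card \<U>) * ennreal ?w"
    using hausdorff_premeasure_le_finite_cover[OF \<U>(1,2) \<open>0 < \<delta>\<close> \<open>\<rho> / real m \<le> \<delta>\<close> \<U>(4)] .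
  also have "\<dots> = ennreal (real (card \<U>) * ?w)"
    using w by (simp add: ennreal_mult ennreal_of_nat_eq_real_of_nat)
  also have "\<dots> \<le> ennreal (real (N * m ^ n) * ?w)"
    using \<U>(3) w by (intro ennreal_leI mult_right_mono) (auto simp only: of_nat_le_iff)
  also have "real (N * m ^ n) * ?w = real N * unit_ball_vol (real n) * (\<rho> / 2) ^ n"
    using \<open>0 < m\<close> by (simp add: field_simps power_divide power_mult_distrib)
  finally show "hausdorff_premeasure n \<delta> A
      \<le> ennreal (real N * unit_ball_vol (real n) * (\<rho> / 2) ^ n)" .
qed

section \<open>Level sets of the distance function\<close>

text \<open>Since \<open>p\<close> lies in \<open>E\<close>, the point \<open>z\<close> is at
  distance at least \<open>r\<close> from \<open>p\<close>. Expanding the square of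
  \<open>z - p = r *\<^sub>R n - (y - z)\<close> turns this into a one-sided quadratic bound on the
  component of \<open>y - z\<close> along the normal at \<open>y\<close>.\<close>

lemma tube_boundary_tangent_bound:
  fixes E :: "'a::real_inner set"
  assumes "p \<in> E" "z \<in> tube_boundary E r" "y = p + r *\<^sub>R n" "norm n = 1" "0 < r"
  shows "(y - z) \<bullet> n \<le> (norm (y - z))\<^sup>2 / (2 * r)"
proof -
  have "r \<le> dist z p" using assms(1,2) infdist_le[of p E z] by (simp add: tube_boundary_def)
  then have "r\<^sup>2 \<le> (norm (r *\<^sub>R n - (y - z)))\<^sup>2"
    using assms(3,5) by (intro power_mono) (auto simp: dist_norm algebra_simps)
  also have "(norm (r *\<^sub>R n - v))\<^sup>2 = r\<^sup>2 - 2 * r * (v \<bullet> n) + (norm v)\<^sup>2" for v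
    using assms(4) unfolding power2_norm_eq_inner
    by (simp add: inner_diff_left inner_diff_right inner_commute norm_eq_1 power2_eq_square)
  finally show ?thesis using assms(5) by (simp add: field_simps)
qed

text \<open>Let \<open>D = CARD('d)\<close>. Near-orthogonality is solved for \<open>w $ i\<close>,
  whose coefficient has size at least \<open>1 / D\<close>, while the other coefficients are at most
  1 in size. This gives \<open>\<bar>w $ i\<bar> \<le> norm w / 2 + D * s\<close>, and the half of
  \<open>norm w\<close> is absorbed on the left. The outcome is at most \<open>4 * D * s\<close>;
  the factor 5 leaves slack.\<close>

lemma norm_le_off_coordinate:
  fixes w n :: "real ^ 'd"
  assumes "1 \<le> real CARD('d) * \<bar>n $ i\<bar>" "norm n = 1"
    and orth: "\<bar>w \<bullet> n\<bar> \<le> norm w / (2 * real CARD('d))"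
  shows "norm w \<le> 5 * real CARD('d) * (\<Sum>j\<in>UNIV - {i}. \<bar>w $ j\<bar>)"
proof -
  define D where "D = real CARD('d)"
  define s where "s = (\<Sum>j\<in>UNIV - {i}. \<bar>w $ j\<bar>)"
  have D: "1 \<le> D" using one_le_card_finite[where 'a = 'd] by (simp add: D_def)
  have "0 \<le> s" by (simp add: s_def sum_nonneg)
  have "norm w \<le> (\<Sum>j\<in>UNIV. \<bar>w $ j\<bar>)" by (rule norm_le_l1_cart)
  then have norm_w: "norm w \<le> \<bar>w $ i\<bar> + s"
    unfolding s_def by (subst (asm) sum.remove[of _ i]) auto
  have "w \<bullet> n = w $ i * n $ i + (\<Sum>j\<in>UNIV - {i}. w $ j * n $ j)"
    unfolding inner_vec_def by (subst sum.remove[of _ i]) auto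
  moreover have "\<bar>\<Sum>j\<in>UNIV - {i}. w $ j * n $ j\<bar> \<le> s"
    unfolding s_def
  proof (rule order_trans[OF sum_abs], rule sum_mono)
    fix j
    have "\<bar>n $ j\<bar> \<le> 1" using component_le_norm_cart[of n j] assms(2) by simp
    then show "\<bar>w $ j * n $ j\<bar> \<le> \<bar>w $ j\<bar>" by (simp add: abs_mult mult_left_le)
  qed
  ultimately have "\<bar>w $ i * n $ i\<bar> \<le> norm w / (2 * D) + s"
    using orth unfolding D_def by linarith
  then have "D * (\<bar>w $ i\<bar> * \<bar>n $ i\<bar>) \<le> D * (norm w / (2 * D) + s)"
    using D by (intro mult_left_mono) (auto simp: abs_mult)
  also have "\<dots> = norm w / 2 + D * s" using D by (simp add: field_simps)
  finally have "D * (\<bar>w $ i\<bar> * \<bar>n $ i\<bar>) \<le> norm w / 2 + D * s" .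
  moreover have "\<bar>w $ i\<bar> * 1 \<le> \<bar>w $ i\<bar> * (D * \<bar>n $ i\<bar>)"
    using assms(1) by (intro mult_left_mono) (auto simp: D_def)
  ultimately have "\<bar>w $ i\<bar> \<le> norm w / 2 + D * s" by (simp add: algebra_simps)
  moreover have "s \<le> D * s" using D \<open>0 \<le> s\<close> by (simp add: mult_le_cancel_right1)
  ultimately show ?thesis using norm_w \<open>0 \<le> s\<close> unfolding D_def s_def by linarith
qed

lemma ex_large_coordinate:
  fixes n :: "real ^ 'd"
  shows "\<exists>i. norm n \<le> real CARD('d) * \<bar>n $ i\<bar>"
proof (rule ccontr)
  assume "\<nexists>i. norm n \<le> real CARD('d) * \<bar>n $ i\<bar>"
  then have "\<bar>n $ i\<bar> < norm n / real CARD('d)" for i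
    by (simp add: field_simps not_le)
  then have "(\<Sum>i\<in>UNIV. \<bar>n $ i\<bar>) < (\<Sum>i\<in>(UNIV :: 'd set). norm n / real CARD('d))"
    by (intro sum_strict_mono) auto
  with norm_le_l1_cart[of n] show False by simp
qed

section \<open>Grid cells in position and direction\<close>

lemma abs_diff_le_if_floor_eq:
  fixes a b c :: real
  assumes "\<lfloor>c * a\<rfloor> = \<lfloor>c * b\<rfloor>" "0 < c"
  shows "\<bar>a - b\<bar> \<le> 1 / c"
proof -
  have "\<bar>c * a - c * b\<bar> \<le> 1" using assms(1) by linarith
  then have "c * \<bar>a - b\<bar> \<le> 1" using assms(2)
    by (metis abs_mult abs_of_pos right_diff_distrib)
  then show ?thesis using assms(2) by (simp add: field_simps)
qed

lemma norm_le_card_mult: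
  fixes v :: "real ^ 'd"
  assumes "\<And>j. \<bar>v $ j\<bar> \<le> c"
  shows "norm v \<le> real CARD('d) * c"
  using order_trans[OF norm_le_l1_cart sum_bounded_above[of UNIV "\<lambda>j. \<bar>v $ j\<bar>" c]] assms
  by auto

lemma floor_mult_in_range:
  assumes "\<bar>t\<bar> \<le> (1::real)"
  shows "\<lfloor>real M * t\<rfloor> \<in> {- int M..int M}"
proof -
  have "\<bar>real M * t\<bar> \<le> real M" using assms by (simp add: abs_mult mult_left_le)
  then show ?thesis by (simp add: le_floor_iff floor_le_iff abs_le_iff)
qed

text \<open>This links the two grids: the quotient of the fine index by \<open>m\<close> is the
  coarse index, so coarse index and remainder together determine the fine one.\<close>

lemma floor_mult_div_nat:
  assumes "0 < m"
  shows "\<lfloor>real m * t\<rfloor> div int m = \<lfloor>t\<rfloor>"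
  using floor_divide_real_eq_div[of "int m" "real m * t"] assms by simp

text \<open>With \<open>D = CARD('d)\<close>, the choice \<open>M = 3 * D\<^sup>2\<close> makes the
  directions differ by at most \<open>1 / (3 * D)\<close> and the positions by at most
  \<open>r / (3 * D)\<close> in norm. The component of \<open>y - z\<close> along \<open>n\<close>
  is then at most \<open>norm (y - z) / (2 * D)\<close> in size, exactly what
  \<open>norm_le_off_coordinate\<close> asks for, and the fine mesh controls the remaining
  coordinates.\<close>

lemma tube_boundary_same_cell:
  fixes E :: "(real ^ 'd) set"
  assumes "0 < r" "0 < m" "M = 3 * CARD('d)\<^sup>2"
    and "p \<in> E" "y \<in> tube_boundary E r" "y = p + r *\<^sub>R n" "norm n = 1"
    and "q \<in> E" "z \<in> tube_boundary E r" "z = q + r *\<^sub>R n'" "norm n' = 1"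
    and i: "1 \<le> real CARD('d) * \<bar>n $ i\<bar>"
    and dir: "\<And>j. \<bar>n $ j - n' $ j\<bar> \<le> 1 / real M"
    and pos: "\<And>j. \<bar>y $ j - z $ j\<bar> \<le> r / real M"
    and fine: "\<And>j. j \<noteq> i \<Longrightarrow> \<bar>y $ j - z $ j\<bar> \<le> r / (real m * real M)"
  shows "dist y z \<le> 2 * r / real m"
proof -
  define D where "D = real CARD('d)"
  have D: "1 \<le> D" using one_le_card_finite[where 'a = 'd] by (simp add: D_def)
  have M: "real M = 3 * D\<^sup>2" by (simp add: assms(3) D_def)
  define w where "w = y - z"
  have nn: "norm (n - n') \<le> 1 / (3 * D)"
    using norm_le_card_mult[of "n - n'" "1 / real M"] dir D
    by (simp add: M D_def[symmetric] power2_eq_square)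
  have nw: "norm w \<le> r / (3 * D)"
    using norm_le_card_mult[of w "r / real M"] pos D
    by (simp add: w_def M D_def[symmetric] power2_eq_square)
  \<comment> \<open>Closeness of \<open>y\<close> and \<open>z\<close> makes the quadratic error of
    the tangent bound linear with a small factor.\<close>
  have q: "(norm w)\<^sup>2 / (2 * r) \<le> norm w / (6 * D)"
  proof -
    have "(norm w)\<^sup>2 / (2 * r) \<le> norm w * (r / (3 * D)) / (2 * r)"
      unfolding power2_eq_square using nw \<open>0 < r\<close>
      by (intro divide_right_mono mult_left_mono) auto
    also have "\<dots> = norm w / (6 * D)" using \<open>0 < r\<close> by simp
    finally show ?thesis .
  qed
  have "w \<bullet> n \<le> (norm w)\<^sup>2 / (2 * r)"
    unfolding w_def by (rule tube_boundary_tangent_bound[OF assms(4,9,6,7,1)])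
  \<comment> \<open>The roles of \<open>y\<close> and \<open>z\<close> are exchanged to bound
    \<open>w\<close> from below along \<open>n'\<close>; replacing \<open>n'\<close> by
    \<open>n\<close> costs \<open>norm w / (3 * D)\<close>.\<close>
  moreover have "- (w \<bullet> n') \<le> (norm w)\<^sup>2 / (2 * r)"
    using tube_boundary_tangent_bound[OF assms(8,5,10,11,1)]
    by (simp add: w_def norm_minus_commute inner_diff_left)
  moreover have "\<bar>w \<bullet> (n - n')\<bar> \<le> norm w / (3 * D)"
    using order_trans[OF Cauchy_Schwarz_ineq2 mult_left_mono[OF nn]] by simp
  ultimately have "\<bar>w \<bullet> n\<bar> \<le> norm w / (6 * D) + norm w / (3 * D)"
    using q by (simp add: inner_diff_right abs_le_iff)
  also have "\<dots> = norm w / (2 * D)" using D by (simp add: field_simps)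
  finally have "norm w \<le> 5 * D * (\<Sum>j\<in>UNIV - {i}. \<bar>w $ j\<bar>)"
    using norm_le_off_coordinate[OF i assms(7)] by (simp add: D_def)
  also have "\<dots> \<le> 5 * D * (D * (r / (real m * real M)))"
  proof (rule mult_left_mono)
    have "(\<Sum>j\<in>UNIV - {i}. \<bar>w $ j\<bar>)
        \<le> real (card (UNIV - {i})) * (r / (real m * real M))"
      using fine by (intro sum_bounded_above) (auto simp: w_def)
    also have "\<dots> \<le> D * (r / (real m * real M))"
      using \<open>0 < r\<close> by (intro mult_right_mono) (auto simp: D_def card_Diff_subset)
    finally show "(\<Sum>j\<in>UNIV - {i}. \<bar>w $ j\<bar>) \<le> D * (r / (real m * real M))" .
  qed (use D in simp)
  \<comment> \<open>Here \<open>5 * D * D / M = 5 / 3\<close>, which is rounded up to 2.\<close>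
  also have "\<dots> = (5 / 3) * (r / real m)" using D by (simp add: M power2_eq_square)
  also have "\<dots> \<le> 2 * (r / real m)" using \<open>0 < r\<close> by (intro mult_right_mono) auto
  finally show ?thesis by (simp add: w_def dist_norm)
qed

text \<open>Each point gets a key from a finite set: a large coordinate of its normal, the coarse
  cells of normal and position, and its place in the fine mesh off that coordinate. The sets of
  points with a common key form the cover, and only the mesh part of the key depends on
  \<open>m\<close>.\<close>

lemma tube_boundary_ball_cover:
  fixes E :: "(real ^ 'd) set"
  assumes "closed E" "E \<noteq> {}" "0 < r" "0 < m" "M = 3 * CARD('d)\<^sup>2"
  shows "\<exists>\<U>. finite \<U> \<and> tube_boundary E r \<inter> cball x r \<subseteq> \<Union>\<U> \<and>
     card \<U> \<le> (CARD('d) * ((2 * M + 1) ^ CARD('d))\<^sup>2) * m ^ (CARD('d) - 1) \<and>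
     (\<forall>U\<in>\<U>. bounded U \<and> diameter U \<le> (2 * r) / real m)"
proof -
  define A where "A = tube_boundary E r \<inter> cball x r"
  have "0 < M" by (simp add: assms(5))
  have "\<exists>p n. p \<in> E \<and> y = p + r *\<^sub>R n \<and> norm n = 1" if "y \<in> A" for y
  proof -
    obtain p where p: "p \<in> E" "infdist y E = dist y p"
      using infdist_attains_inf[OF assms(1,2)] by blast
    then have "dist y p = r" using that by (simp add: A_def tube_boundary_def)
    then have "y = p + r *\<^sub>R ((1 / r) *\<^sub>R (y - p))" "norm ((1 / r) *\<^sub>R (y - p)) = 1"
      using \<open>0 < r\<close> by (auto simp: dist_norm)
    then show ?thesis using p(1) by blast
  qed
  then obtain p n where pn: "\<And>y. y \<in> A \<Longrightarrow> p y \<in> E \<and> y = p y + r *\<^sub>R n y \<and> norm (n y) = 1"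
    by metis
  \<comment> \<open>The bound uses \<open>norm (n y)\<close> instead of 1, so it holds for every
    \<open>y\<close>, also outside \<open>A\<close> where nothing is known about
    \<open>n y\<close>.\<close>
  have "\<exists>i. \<forall>y. norm (n y) \<le> real CARD('d) * \<bar>n y $ i y\<bar>"
    by (intro choice allI ex_large_coordinate)
  then obtain i where i: "\<And>y. norm (n y) \<le> real CARD('d) * \<bar>n y $ i y\<bar>"
    by blast
  \<comment> \<open>Rescaling maps the ball to the unit ball, so coordinates of positions and of
    normals both lie in \<open>[-1, 1]\<close>.\<close>
  define u where "u y j = (y $ j - x $ j) / r" for y j
  define dir where "dir y = (\<lambda>j. \<lfloor>real M * n y $ j\<rfloor>)" for y
  define pos where "pos y = (\<lambda>j. \<lfloor>real M * u y j\<rfloor>)" for y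
  \<comment> \<open>Only the remainder is kept, since \<open>pos\<close> supplies the quotient: this
    leaves \<open>m\<close> values per coordinate. Coordinate \<open>i y\<close> is frozen at 0,
    which gives the exponent \<open>CARD('d) - 1\<close>.\<close>
  define mesh where
    "mesh y = (\<lambda>j. if j = i y then 0 else \<lfloor>real m * (real M * u y j)\<rfloor> mod int m)" for y
  define key where "key y = (i y, dir y, pos y, mesh y)" for y
  define F where "F = (\<Pi>\<^sub>E j\<in>(UNIV :: 'd set). {- int M..int M})"
  define G where "G i = (\<Pi>\<^sub>E j\<in>(UNIV :: 'd set). if j = i then {0} else {0..<int m})" for i
  define T where "T = (SIGMA i : UNIV. F \<times> F \<times> G i)"
  define \<U> where "\<U> = (\<lambda>t. {y \<in> A. key y = t}) ` T"
  have finF: "finite F" and cardF: "card F = (2 * M + 1) ^ CARD('d)"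
    by (auto simp: F_def card_PiE finite_PiE nat_add_distrib nat_mult_distrib)
  have finG: "finite (G i)" for i by (auto simp: G_def intro!: finite_PiE)
  have cardG: "card (G i) = m ^ (CARD('d) - 1)" for i
  proof -
    have "card (G i) = (\<Prod>j\<in>UNIV. if j = i then 1 else m)"
      unfolding G_def by (subst card_PiE) (auto intro!: prod.cong)
    also have "\<dots> = (\<Prod>j\<in>UNIV - {i}. m)"
      by (subst prod.remove[of _ i]) (auto intro!: prod.cong)
    finally show ?thesis by (simp add: card_Diff_subset)
  qed
  have finT: "finite T" using finF finG by (auto simp: T_def)
  have "card T = CARD('d) * (card F * (card F * m ^ (CARD('d) - 1)))"
    unfolding T_def using finF finG by (subst card_SigmaI) (auto simp: card_cartesian_product cardG)
  then have cardT: "card T = (CARD('d) * ((2 * M + 1) ^ CARD('d))\<^sup>2) * m ^ (CARD('d) - 1)"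
    by (simp add: cardF power2_eq_square)
  have keyT: "key y \<in> T" if "y \<in> A" for y
  proof -
    have "\<bar>n y $ j\<bar> \<le> 1" for j using component_le_norm_cart[of "n y" j] pn[OF that] by simp
    then have "dir y \<in> F" using floor_mult_in_range by (auto simp: dir_def F_def)
    moreover have "\<bar>u y j\<bar> \<le> 1" for j
    proof -
      have "\<bar>y $ j - x $ j\<bar> \<le> r"
        using component_le_norm_cart[of "y - x" j] that
        by (simp add: A_def dist_norm norm_minus_commute)
      then show ?thesis using \<open>0 < r\<close> by (simp add: u_def)
    qed
    then have "pos y \<in> F" using floor_mult_in_range by (auto simp: pos_def F_def)
    moreover have "mesh y \<in> G (i y)" using \<open>0 < m\<close> by (auto simp: mesh_def G_def)
    ultimately show ?thesis by (simp add: key_def T_def)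
  qed
  have cell: "dist y z \<le> 2 * r / real m" if yz: "y \<in> A" "z \<in> A" "key y = key z" for y z
  proof (rule tube_boundary_same_cell[OF \<open>0 < r\<close> \<open>0 < m\<close> assms(5)])
    have eqs: "i y = i z" "dir y = dir z" "pos y = pos z" "mesh y = mesh z"
      using yz(3) by (auto simp: key_def)
    show "p y \<in> E" "y = p y + r *\<^sub>R n y" "norm (n y) = 1" using pn[OF yz(1)] by auto
    show "p z \<in> E" "z = p z + r *\<^sub>R n z" "norm (n z) = 1" using pn[OF yz(2)] by auto
    show "y \<in> tube_boundary E r" "z \<in> tube_boundary E r" using yz by (auto simp: A_def)
    show "1 \<le> real CARD('d) * \<bar>n y $ i y\<bar>" using i[of y] pn[OF yz(1)] by simp
    show "\<bar>n y $ j - n z $ j\<bar> \<le> 1 / real M" for j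
      using fun_cong[OF eqs(2), of j] \<open>0 < M\<close>
      by (intro abs_diff_le_if_floor_eq) (auto simp: dir_def)
    have scale: "\<bar>y $ j - z $ j\<bar> \<le> r / c" if "\<bar>u y j - u z j\<bar> \<le> 1 / c" "0 < c" for j c
    proof -
      have "u y j - u z j = (y $ j - z $ j) / r"
        by (simp add: u_def diff_divide_distrib)
      then have "\<bar>y $ j - z $ j\<bar> = r * \<bar>u y j - u z j\<bar>"
        using \<open>0 < r\<close> by (simp add: abs_divide)
      also have "\<dots> \<le> r * (1 / c)" using that \<open>0 < r\<close> by (intro mult_left_mono) auto
      finally show ?thesis by simp
    qed
    show "\<bar>y $ j - z $ j\<bar> \<le> r / real M" for j
      using fun_cong[OF eqs(3), of j] \<open>0 < M\<close>
      by (intro scale abs_diff_le_if_floor_eq) (auto simp: pos_def)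
    show "\<bar>y $ j - z $ j\<bar> \<le> r / (real m * real M)" if "j \<noteq> i y" for j
    proof -
      let ?a = "\<lfloor>real m * (real M * u y j)\<rfloor>" and ?b = "\<lfloor>real m * (real M * u z j)\<rfloor>"
      have "?a mod int m = ?b mod int m"
        using fun_cong[OF eqs(4), of j] that eqs(1) by (simp add: mesh_def)
      moreover have "?a div int m = ?b div int m"
        using fun_cong[OF eqs(3), of j] \<open>0 < m\<close> by (simp add: floor_mult_div_nat pos_def)
      ultimately have "?a = ?b" by (metis div_mult_mod_eq)
      then show ?thesis using \<open>0 < m\<close> \<open>0 < M\<close>
        by (intro scale abs_diff_le_if_floor_eq) (auto simp: mult.assoc)
    qed
  qed
  have "bounded U \<and> diameter U \<le> (2 * r) / real m" if U: "U \<in> \<U>" for U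
  proof
    have "U \<subseteq> cball x r" using U by (auto simp: \<U>_def A_def)
    then show "bounded U" using bounded_subset bounded_cball by blast
    show "diameter U \<le> (2 * r) / real m"
      using U cell \<open>0 < r\<close> by (intro diameter_le) (auto simp: \<U>_def dist_norm)
  qed
  moreover have "A \<subseteq> \<Union>\<U>" using keyT by (auto simp: \<U>_def)
  moreover have "finite \<U>" using finT by (simp add: \<U>_def)
  moreover have "card \<U> \<le> card T" using finT by (simp add: \<U>_def card_image_le)
  ultimately show ?thesis unfolding A_def cardT by blast
qed

section \<open>Whitney layers\<close>

text \<open>The centre of a Whitney ball of radius \<open>s\<close> is at distance
  \<open>8 * s\<close> from \<open>E\<close>, so a point of the ball is at distance between
  \<open>7 * s\<close> and \<open>9 * s\<close>. Knowing \<open>r\<close> up to a factor 2 then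
  confines \<open>s\<close> to three dyadic ranges.\<close>

lemma whitney_layer_covers_tube_boundary:
  fixes E :: "'a::metric_space set"
  assumes "closed E" "whitney_cover (- E) W"
    and r: "2 powi (- k - 1) < r" "r \<le> 2 powi (- k)"
    and y: "y \<in> tube_boundary E r" "y \<in> A"
  shows "\<exists>j\<in>{k + 2 .. k + 4}. \<exists>B\<in>whitney_layer (- E) W j A. y \<in> B"
proof -
  define q :: real where "q = 2 powi (- k)"
  have "0 < q" by (simp add: q_def)
  have pw: "2 powi (- k - int l) = q / 2 ^ l" for l
    by (simp add: q_def power_int_diff)
  have r': "q / 2 < r" "r \<le> q" using r pw[of 1] by (auto simp: q_def)
  have "y \<notin> E" using y(1) r' \<open>0 < q\<close> by (auto simp: tube_boundary_def)
  then obtain B x where B: "B \<in> W" "y \<in> B" "x \<in> - E" "B = cball x (whitney_radius (- E) x)"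
    using assms(2) unfolding whitney_cover_def by blast
  define s where "s = whitney_radius (- E) x"
  have s: "infdist x E = 8 * s" by (simp add: s_def whitney_radius_def)
  have "dist x y \<le> s" using B by (simp add: s_def)
  moreover have "infdist y E = r" using y(1) by (simp add: tube_boundary_def)
  ultimately have "7 * s \<le> r" "r \<le> 9 * s"
    using infdist_triangle[of x E y] infdist_triangle[of y E x] s by (auto simp: dist_commute)
  \<comment> \<open>From \<open>r / 9 \<le> s \<le> r / 7\<close> and
    \<open>q / 2 < r \<le> q\<close> follows \<open>q / 18 < s \<le> q / 7\<close>; the bounds are
    relaxed to the ends of the layers \<open>k + 4\<close> and \<open>k + 2\<close>.\<close>
  then have sq: "q / 32 < s" "s \<le> q / 4" using r' \<open>0 < q\<close> by linarith+
  have mem: "B \<in> whitney_layer (- E) W (k + int l) A" if "q / 2 ^ (l + 1) < s" "s \<le> q / 2 ^ l" for l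
    unfolding whitney_layer_def
    using B y(2) that pw[of l] pw[of "l + 1"] unfolding s_def
    by (auto simp: algebra_simps intro!: bexI[of _ x])
  consider "q / 8 < s" | "q / 16 < s" "s \<le> q / 8" | "s \<le> q / 16" by linarith
  then have "\<exists>l\<in>{2..4}. B \<in> whitney_layer (- E) W (k + int l) A"
  proof cases
    case 1 then show ?thesis using mem[of 2] sq by (intro bexI[of _ 2]) auto
  next
    case 2 then show ?thesis using mem[of 3] sq by (intro bexI[of _ 3]) auto
  next
    case 3 then show ?thesis using mem[of 4] sq by (intro bexI[of _ 4]) auto
  qed
  then obtain l where "l \<in> {2..4}" "B \<in> whitney_layer (- E) W (k + int l) A" by blast
  then show ?thesis using B(2) by (intro bexI[of _ "k + int l"] bexI[of _ B]) auto
qed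

lemma whitney_layer_subset_cball:
  assumes "B \<in> whitney_layer \<Omega> W j A" "2 powi (- j) \<le> r"
  shows "\<exists>x. B \<subseteq> cball x r"
proof -
  obtain x where "B = cball x (whitney_radius \<Omega> x)" "whitney_radius \<Omega> x \<le> 2 powi (- j)"
    using assms(1) unfolding whitney_layer_def by blast
  then show ?thesis using assms(2) by (intro exI[of _ x]) auto
qed

section \<open>Summing over Whitney balls\<close>

lemma hausdorff_measure_tube_boundary_le:
  fixes E :: "(real ^ 'd) set"
  assumes "closed E" "E \<noteq> {}" "0 < r"
    and "finite \<B>" "A \<subseteq> tube_boundary E r" "A \<subseteq> \<Union>\<B>" "\<And>B. B \<in> \<B> \<Longrightarrow> \<exists>x. B \<subseteq> cball x r"
  shows "hausdorff_measure (CARD('d) - 1) A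
    \<le> ennreal (real (card \<B> * (CARD('d) * ((2 * (3 * CARD('d)\<^sup>2) + 1) ^ CARD('d))\<^sup>2))
        * unit_ball_vol (real (CARD('d) - 1)) * r ^ (CARD('d) - 1))"
proof -
  define N where "N = CARD('d) * ((2 * (3 * CARD('d)\<^sup>2) + 1) ^ CARD('d))\<^sup>2"
  let ?n = "CARD('d) - 1"
  \<comment> \<open>The diameters are at most \<open>2 * r / m\<close>, and the division by 2 in the
    weight restores \<open>r ^ ?n\<close>.\<close>
  have "hausdorff_measure ?n A
      \<le> ennreal (real (card \<B> * N) * unit_ball_vol (real ?n) * (2 * r / 2) ^ ?n)"
  proof (rule hausdorff_measure_le_covers)
    fix m :: nat assume "0 < m"
    have "\<exists>\<U>. finite \<U> \<and> tube_boundary E r \<inter> B \<subseteq> \<Union>\<U> \<and> card \<U> \<le> N * m ^ ?n \<and>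
        (\<forall>U\<in>\<U>. bounded U \<and> diameter U \<le> (2 * r) / real m)" if B: "B \<in> \<B>" for B
    proof -
      obtain x where "B \<subseteq> cball x r" using assms(7)[OF B] by blast
      then show ?thesis
        using tube_boundary_ball_cover[OF assms(1-3) \<open>0 < m\<close> refl, of x]
        unfolding N_def by (meson Int_mono order_refl order_trans)
    qed
    then obtain \<U> where \<U>: "\<And>B. B \<in> \<B> \<Longrightarrow> finite (\<U> B) \<and> tube_boundary E r \<inter> B \<subseteq> \<Union>(\<U> B)
        \<and> card (\<U> B) \<le> N * m ^ ?n \<and> (\<forall>U\<in>\<U> B. bounded U \<and> diameter U \<le> (2 * r) / real m)"
      by metis
    \<comment> \<open>The covers of the single pieces are united at the same mesh \<open>m\<close>,
      so their number is multiplied by at most \<open>card \<B>\<close>.\<close>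
    have "card (\<Union>B\<in>\<B>. \<U> B) \<le> (\<Sum>B\<in>\<B>. card (\<U> B))"
      by (rule card_UN_le[OF assms(4)])
    also have "\<dots> \<le> card \<B> * (N * m ^ ?n)"
      using \<U> sum_bounded_above[of \<B> "\<lambda>B. card (\<U> B)" "N * m ^ ?n"] by simp
    finally have "card (\<Union>B\<in>\<B>. \<U> B) \<le> card \<B> * N * m ^ ?n" by (simp add: mult.assoc)
    moreover have "A \<subseteq> \<Union>(\<Union>B\<in>\<B>. \<U> B)"
    proof
      fix y assume "y \<in> A"
      then obtain B where "B \<in> \<B>" "y \<in> tube_boundary E r \<inter> B" using assms(5,6) by blast
      then show "y \<in> \<Union>(\<Union>B\<in>\<B>. \<U> B)" using \<U>[of B] by blast
    qed
    moreover have "finite (\<Union>B\<in>\<B>. \<U> B)" using \<U> assms(4) by blast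
    ultimately show "\<exists>\<U>. finite \<U> \<and> A \<subseteq> \<Union>\<U> \<and> card \<U> \<le> card \<B> * N * m ^ ?n \<and>
        (\<forall>U\<in>\<U>. bounded U \<and> diameter U \<le> 2 * r / real m)"
      using \<U> by (intro exI[of _ "\<Union>B\<in>\<B>. \<U> B"]) blast
  qed (use assms(3) in simp)
  then show ?thesis by (simp add: N_def)
qed

theorem proposition5p6:
  "\<exists>C::real. C \<ge> 1 \<and>
     (\<forall>(E :: (real ^ 'd) set) W x0 R k r.
        closed E \<longrightarrow> E \<noteq> {} \<longrightarrow> E \<noteq> UNIV \<longrightarrow>
        whitney_cover (- E) W \<longrightarrow>
        x0 \<in> E \<longrightarrow> 0 < R \<longrightarrow>
        2 powi (- k - 1) < r \<longrightarrow> r \<le> 2 powi (- k) \<longrightarrow>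
        hausdorff_measure (CARD('d) - 1) (tube_boundary E r \<inter> cball x0 R)
          \<le> ennreal (C * r ^ (CARD('d) - 1)) *
             (\<Sum>j\<in>{k + 2 .. k + 4}. ennreal_card (whitney_layer (- E) W j (cball x0 R))))"
proof -
  define n where "n = CARD('d) - 1"
  define N where "N = CARD('d) * ((2 * (3 * CARD('d)\<^sup>2) + 1) ^ CARD('d))\<^sup>2"
  define C where "C = max 1 (real N * unit_ball_vol (real n))"
  have "hausdorff_measure n (tube_boundary E r \<inter> cball x0 R)
      \<le> ennreal (C * r ^ n) * (\<Sum>j\<in>{k + 2 .. k + 4}. ennreal_card (whitney_layer (- E) W j (cball x0 R)))"
    if E: "closed E" "E \<noteq> {}" and W: "whitney_cover (- E) W"
      and r: "2 powi (- k - 1) < r" "r \<le> 2 powi (- k)"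
    for E :: "(real ^ 'd) set" and W x0 R k r
  proof -
    define L where "L j = whitney_layer (- E) W j (cball x0 R)" for j
    have "0 < r" using r(1) by (meson less_trans zero_less_numeral zero_less_power_int)
    have "1 \<le> C" by (simp add: C_def)
    have Cr: "0 < C * r ^ n" using \<open>0 < r\<close> \<open>1 \<le> C\<close> by simp
    show ?thesis
    \<comment> \<open>If some layer is infinite, the right-hand side is \<open>top\<close>, because
      the factor \<open>C * r ^ n\<close> is positive.\<close>
    proof (cases "\<forall>j\<in>{k + 2..k + 4}. finite (L j)")
      case False
      then obtain j where j: "j \<in> {k + 2..k + 4}" "infinite (L j)" by blast
      then have "ennreal_card (L j) = top" by (simp add: ennreal_card_def)
      then have "(\<Sum>j\<in>{k + 2..k + 4}. ennreal_card (L j)) = top"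
        using j(1) by (meson ennreal_sum_eq_top finite_atLeastAtMost_int infinity_ennreal_def)
      then show ?thesis using Cr \<open>1 \<le> C\<close> \<open>0 < r\<close>
        by (simp only: flip: L_def) (simp add: ennreal_mult_top)
    next
      case True
      define \<B> where "\<B> = (\<Union>j\<in>{k + 2..k + 4}. L j)"
      have "finite \<B>" using True by (simp add: \<B>_def)
      have "card \<B> \<le> (\<Sum>j\<in>{k + 2..k + 4}. card (L j))"
        unfolding \<B>_def by (rule card_UN_le) simp
      then have "of_nat (card \<B>) \<le> (of_nat (\<Sum>j\<in>{k + 2..k + 4}. card (L j)) :: ennreal)"
        by (simp only: of_nat_le_iff)
      also have "\<dots> = (\<Sum>j\<in>{k + 2..k + 4}. ennreal_card (L j))"
        using True by (auto simp: ennreal_card_def emeasure_count_space intro!: sum.cong)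
      finally have card: "of_nat (card \<B>) \<le> (\<Sum>j\<in>{k + 2..k + 4}. ennreal_card (L j))" .
      have "\<exists>x. B \<subseteq> cball x r" if "B \<in> \<B>" for B
      proof -
        obtain j where j: "j \<in> {k + 2..k + 4}" "B \<in> L j"
          using \<open>B \<in> \<B>\<close> by (auto simp: \<B>_def)
        \<comment> \<open>Layers start at \<open>k + 2\<close>, so their balls have radius below
          \<open>r\<close>, and each fits in one ball of radius \<open>r\<close> to which the cover
          estimate applies.\<close>
        have "(2::real) powi (- j) \<le> 2 powi (- k - 1)"
          using j(1) by (intro power_int_increasing) auto
        then show ?thesis using j(2) r(1) unfolding L_def
          by (intro whitney_layer_subset_cball) auto
      qed
      moreover have "tube_boundary E r \<inter> cball x0 R \<subseteq> \<Union>\<B>"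
        using whitney_layer_covers_tube_boundary[OF E(1) W r] unfolding \<B>_def L_def by blast
      ultimately have "hausdorff_measure n (tube_boundary E r \<inter> cball x0 R)
          \<le> ennreal (real (card \<B> * N) * unit_ball_vol (real n) * r ^ n)"
        using hausdorff_measure_tube_boundary_le[OF E \<open>0 < r\<close> \<open>finite \<B>\<close>]
        unfolding n_def N_def by simp
      also have "real (card \<B> * N) * unit_ball_vol (real n) * r ^ n
          = (real N * unit_ball_vol (real n)) * (r ^ n * real (card \<B>))" by simp
      also have "ennreal \<dots> \<le> ennreal (C * (r ^ n * real (card \<B>)))"
        using \<open>0 < r\<close> by (intro ennreal_leI mult_right_mono) (auto simp: C_def)
      also have "\<dots> = ennreal (C * r ^ n) * of_nat (card \<B>)"
        using Cr by (simp add: ennreal_mult ennreal_of_nat_eq_real_of_nat flip: mult.assoc)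
      also have "\<dots> \<le> ennreal (C * r ^ n) * (\<Sum>j\<in>{k + 2..k + 4}. ennreal_card (L j))"
        using card by (rule mult_left_mono) simp
      finally show ?thesis unfolding L_def .
    qed
  qed
  moreover have "1 \<le> C" by (simp add: C_def)
  ultimately show ?thesis unfolding n_def by blast
qed

end
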